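(* For every $n\in\mathbb{N}$, there is a $\tfrac{4}{3}^+$-free circular word of length $2n$ over an alphabet of $5$ letters.
   Context: A word $w=w_1\cdots w_n$ has period $p\ge 1$ if $w_{i+p}=w_i$ for all $1\le i\le n-p$ (so $n$ is always a period). The exponent of a nonempty word is its length divided by its minimal period. Two words $x,y$ are conjugates if $x=uv$ and $y=vu$ for some words $u,v$. For a word $w$, the circular word $(w)$ is the set of all conjugates of $w$; its length is $|w|$. A word is a factor of $(w)$ if it is a (contiguous) factor of some conjugate of $w$. A (linear or circular) word is $\beta^+$-free if it has no factor of exponent strictly greater than $\beta$. *)

theory Defs
  imports Complex_Main "HOL-Library.Sublist"
begin

definition has_period :: "'a list \<Rightarrow> nat \<Rightarrow> bool" where
  "has_period w p \<longleftrightarrow> p \<ge> 1 \<and> (\<forall>i. i + p < length w \<longrightarrow> w ! (i + p) = w ! i)"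

definition min_period :: "'a list \<Rightarrow> nat" where
  "min_period w = (LEAST p. has_period w p)"

(* Meaningful for nonempty words only. *)
definition exponent :: "'a list \<Rightarrow> real" where
  "exponent w = real (length w) / real (min_period w)"

definition conjugates :: "'a list \<Rightarrow> 'a list \<Rightarrow> bool" where
  "conjugates x y \<longleftrightarrow> (\<exists>u v. x = u @ v \<and> y = v @ u)"

definition circular_word :: "'a list \<Rightarrow> 'a list set" where
  "circular_word w = {x. conjugates w x}"

(* The predicate sublist of HOL-Library.Sublist is the contiguous factor relation. *)
definition circular_factor :: "'a list \<Rightarrow> 'a list set \<Rightarrow> bool" where
  "circular_factor u C \<longleftrightarrow> (\<exists>x\<in>C. sublist u x)"

(* Being beta^+-free: factors of exponent exactly beta are allowed. *)
definition circular_plus_free :: "real \<Rightarrow> 'a list set \<Rightarrow> bool" where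
  "circular_plus_free \<beta> C \<longleftrightarrow> \<not> (\<exists>u. u \<noteq> [] \<and> circular_factor u C \<and> exponent u > \<beta>)"

end

theory Submission
  imports Defs
begin

text \<open>
  Long circular words are built as g(u) h(rev u) X, where u is a prefix of an infinite word over ten
  letters that contains no factor of exponent greater than 5/4, g and h replace
  every letter by eight letters of \<open>{0..<5}\<close>, and X is a fixed bridge whose length (10, 12, ..., 24)
  adjusts the total length modulo 16. Six consecutive letters determine the morphism (g, h or X), the
  source letter and the position in its image. Hence two equal long factors at distance p both lie
  in g(u) or both in h(rev u). Either the path of length p between them stays inside that half, and
  they come from a repetition in u, whose exponent of at most 5/4 leaves room for the unsynchronized
  margin; or the path crosses the other half and is therefore too long for exponent above 4/3.
  Distances below 18 are a finite check. Taking the reversal of u fixes the letters on both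
  sides of X, so that one bridge per length suffices. The words u, g, h, X and the short words
  below length 58 were found by a computer search.
\<close>

section \<open>Checking for repetitions by rewriting\<close>

lemma mod_add_left_cancel_nat: "(a + x) mod m = (a + y) mod m \<longleftrightarrow> x mod m = y mod (m :: nat)"
proof -
  have "(a + x) mod m = (a + y) mod m \<longleftrightarrow> x mod m = y mod m" if "x \<le> y" for x y
    using that by (metis (no_types) add_diff_cancel_left add_left_mono mod_eq_dvd_iff_nat)
  then show ?thesis by (metis nat_le_linear)
qed


text \<open>Scans two words in parallel for \<open>l\<close> consecutive agreements. The countdown
  \<open>c\<close> holds the agreements still missing from the current run; a mismatch resets it to
  \<open>l\<close>.\<close>

fun no_run :: "nat \<Rightarrow> nat \<Rightarrow> nat list \<Rightarrow> nat list \<Rightarrow> bool" where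
  "no_run l c (x # xs) (y # ys) =
     (if x = y then (if c = 1 then False else no_run l (c - 1) xs ys) else no_run l l xs ys)"
| "no_run l c [] ys = True"
| "no_run l c (x # xs) [] = True"

text \<open>A factor of length \<open>p + l\<close> and period \<open>p\<close> has exponent above 1
  + 1/k iff \<open>l\<close> exceeds p/k, hence the run length \<open>p div k + 1\<close>. The word
  \<open>ys\<close> is meant to be the rest of \<open>xs\<close> after position
  \<open>p\<close>.\<close>

fun no_runs :: "nat \<Rightarrow> nat \<Rightarrow> nat \<Rightarrow> nat list \<Rightarrow> nat list \<Rightarrow> bool" where
  "no_runs k n p xs (y # ys) =
     (if p + p div k < n then no_run (p div k + 1) (p div k + 1) xs (y # ys) \<and> no_runs k n (p + 1) xs ys
      else True)"
| "no_runs k n p xs [] = True"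

fun run_free :: "nat \<Rightarrow> nat \<Rightarrow> nat list \<Rightarrow> bool" where
  "run_free k n (x # xs) = no_runs k n 1 (x # xs) xs"
| "run_free k n [] = True"

text \<open>
  Congruence rules that keep the simplifier from traversing the literal words again at every step.
\<close>

lemma no_run_weak_cong: "c = c' \<Longrightarrow> l = l' \<Longrightarrow> no_run l c xs ys = no_run l' c' xs ys"
  and no_runs_weak_cong: "p = p' \<Longrightarrow> no_runs k n p xs ys = no_runs k n p' xs ys"
  by simp_all

text \<open>The first conjunct treats the run in progress, which \<open>c\<close> more agreements
  would complete. It supplies the windows at offset 0 via \<open>c \<le> l\<close>; later windows
  come from the tails.\<close>

lemma no_run_sound:
  assumes "no_run l c xs ys" "1 \<le> c" "c \<le> l"
  shows "(c \<le> min (length xs) (length ys) \<longrightarrow> (\<exists>j<c. xs ! j \<noteq> ys ! j)) \<and>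
    (\<forall>r. r + l \<le> min (length xs) (length ys) \<longrightarrow> (\<exists>j<l. xs ! (r + j) \<noteq> ys ! (r + j)))"
  using assms
proof (induction l c xs ys rule: no_run.induct)
  case (1 l c x xs y ys)
  show ?case
  proof (cases "x = y")
    case True
    with "1.prems" have c: "c \<noteq> 1" and run: "no_run l (c - 1) xs ys"
      by (auto split: if_splits)
    have IH: "(c - 1 \<le> min (length xs) (length ys) \<longrightarrow> (\<exists>j<c - 1. xs ! j \<noteq> ys ! j)) \<and>
      (\<forall>r. r + l \<le> min (length xs) (length ys) \<longrightarrow> (\<exists>j<l. xs ! (r + j) \<noteq> ys ! (r + j)))"
      using "1.IH"(1)[OF True c run] "1.prems" c by auto
    have A: "\<exists>j<c. (x # xs) ! j \<noteq> (y # ys) ! j" if "c \<le> min (length (x # xs)) (length (y # ys))"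
    proof -
      from that c "1.prems"(2) have "c - 1 \<le> min (length xs) (length ys)" by auto
      with IH obtain j where "j < c - 1" "xs ! j \<noteq> ys ! j" by blast
      then show ?thesis by (intro exI[of _ "Suc j"]) auto
    qed
    have B: "\<exists>j<l. (x # xs) ! (r + j) \<noteq> (y # ys) ! (r + j)"
      if "r + l \<le> min (length (x # xs)) (length (y # ys))" for r
    proof (cases r)
      case 0
      with A that "1.prems" obtain j where "j < c" "(x # xs) ! j \<noteq> (y # ys) ! j" by auto
      with 0 "1.prems" show ?thesis by (intro exI[of _ j]) auto
    next
      case (Suc r')
      with that IH have "\<exists>j<l. xs ! (r' + j) \<noteq> ys ! (r' + j)" by auto
      with Suc show ?thesis by auto
    qed
    from A B show ?thesis by blast
  next
    case False
    with "1.prems" have run: "no_run l l xs ys" by auto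
    have IH: "\<forall>r. r + l \<le> min (length xs) (length ys) \<longrightarrow> (\<exists>j<l. xs ! (r + j) \<noteq> ys ! (r + j))"
      using "1.IH"(2)[OF False run] "1.prems" by auto
    have B: "\<exists>j<l. (x # xs) ! (r + j) \<noteq> (y # ys) ! (r + j)"
      if "r + l \<le> min (length (x # xs)) (length (y # ys))" for r
    proof (cases r)
      case 0
      with False "1.prems" show ?thesis by (intro exI[of _ 0]) auto
    next
      case (Suc r')
      with that IH have "\<exists>j<l. xs ! (r' + j) \<noteq> ys ! (r' + j)" by auto
      with Suc show ?thesis by auto
    qed
    have "\<exists>j<c. (x # xs) ! j \<noteq> (y # ys) ! j"
      using False "1.prems" by (intro exI[of _ 0]) auto
    with B show ?thesis by blast
  qed
qed auto

text \<open>Induction on the distances tested before \<open>p'\<close>. As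
  \<open>p + p div k\<close> grows with \<open>p\<close>, a guard that holds at \<open>p'\<close>
  has not stopped the recursion earlier.\<close>

lemma no_runs_sound:
  assumes "no_runs k n p xs (drop p xs)" "p \<le> p'" "p' + p' div k < n" "r + p' + p' div k < length xs"
  shows "\<exists>j\<le>p' div k. xs ! (r + j) \<noteq> xs ! (r + p' + j)"
  using assms
proof (induction "p' - p" arbitrary: p)
  case 0
  then have p: "p = p'" by simp
  from "0.prems" p obtain y ys where d: "drop p xs = y # ys"
    by (cases "drop p xs") auto
  with "0.prems" p have "no_run (p div k + 1) (p div k + 1) xs (drop p xs)" by auto
  from no_run_sound[OF this] 
  have "r + (p div k + 1) \<le> min (length xs) (length (drop p xs)) \<longrightarrow>
     (\<exists>j<p div k + 1. xs ! (r + j) \<noteq> drop p xs ! (r + j))" by simp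
  with "0.prems" p show ?case by (auto simp: less_Suc_eq_le algebra_simps)
next
  case (Suc x)
  then have p: "p < p'" by simp
  then have le: "p + p div k < n" using Suc.prems(3) div_le_mono[of p p' k] by linarith
  from Suc.prems p obtain y ys where d: "drop p xs = y # ys"
    by (cases "drop p xs") auto
  then have ys: "ys = drop (Suc p) xs" by (metis drop_Suc list.sel(3) tl_drop)
  from Suc.prems(1) d le have "no_runs k n (Suc p) xs ys" by simp
  with Suc(1)[of "Suc p"] Suc.prems Suc(2) ys show ?case by simp
qed

lemma run_free_sound:
  assumes "run_free k n xs" "1 \<le> p" "p + p div k < n" "r + p + p div k < length xs"
  shows "\<exists>j\<le>p div k. xs ! (r + j) \<noteq> xs ! (r + p + j)"
proof -
  from assms(1) have "no_runs k n 1 xs (drop 1 xs)" by (cases xs) auto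
  from no_runs_sound[OF this assms(2-4)] show ?thesis .
qed

section \<open>Consistency of finite tables\<close>

fun agree :: "'a \<Rightarrow> 'b \<Rightarrow> ('a \<times> 'b) list \<Rightarrow> bool" where
  "agree k v ((k', v') # xs) = ((k = k' \<longrightarrow> v = v') \<and> agree k v xs)"
| "agree k v [] = True"

fun functional :: "('a \<times> 'b) list \<Rightarrow> bool" where
  "functional ((k, v) # xs) = (agree k v xs \<and> functional xs)"
| "functional [] = True"

text \<open>As congruence rules these freeze the table: only the key of \<open>agree\<close> is
  simplified, and nothing below \<open>functional\<close>.\<close>

lemma agree_weak_cong: "k = k' \<Longrightarrow> agree k v xs = agree k' v xs"
  and functional_weak_cong: "functional xs = functional xs"
  by simp_all

text \<open>Splits a check into two phases: the table is first rewritten to a literal list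
  \<open>ys\<close>, and only that literal is tested.\<close>

lemma functional_eval: "xs = ys \<Longrightarrow> functional ys \<Longrightarrow> functional xs"
  by simp

lemma agree_iff: "agree k v xs \<longleftrightarrow> (\<forall>v'. (k, v') \<in> set xs \<longrightarrow> v = v')"
  by (induction k v xs rule: agree.induct) auto

lemma functional_sound: "functional xs \<Longrightarrow> (k, v) \<in> set xs \<Longrightarrow> (k, v') \<in> set xs \<Longrightarrow> v = v'"
  by (induction xs rule: functional.induct) (auto simp: agree_iff)


section \<open>A word over ten letters without factors of exponent above 5/4\<close>

text \<open>
  The letters of the word are the values of \<open>tau\<close> modulo 10. Working with the unreduced values makes
  every increment 1 or 2. Modulo 10, \<open>tau\<close> is the fixed point of the morphism that maps a to the
  27 letters a + c with c in \<open>cum\<close>.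
\<close>

definition cum :: "nat list" where
  "cum = [0,1,2,4,6,7,9,11,13,15,17,18,19,20,22,24,26,28,30,31,33,34,35,36,37,39,40]"

function tau :: "nat \<Rightarrow> nat" where
  "tau n = (if n = 0 then 0 else 40 * (n div 27) + tau (n div 27) + cum ! (n mod 27))"
  by auto
termination by (relation "measure id") auto

declare tau.simps [simp del]

lemma tau_block: "r < 27 \<Longrightarrow> tau (27 * q + r) = 40 * q + tau q + cum ! r"
  by (cases "q = 0 \<and> r = 0") (simp_all add: tau.simps[of 0] tau.simps[of "27 * q + r"] cum_def)

lemma tau_0: "tau 0 = 0" 
  by (simp add: tau.simps)

lemma all_less_Suc: "(\<forall>i<Suc n. P i) \<longleftrightarrow> P n \<and> (\<forall>i<n. P i)"
  by (auto simp: less_Suc_eq)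

lemma cum_step: "\<forall>r<26. cum ! Suc r = cum ! r + 1 \<or> cum ! Suc r = cum ! r + 2"
  by (simp add: cum_def numeral_eq_Suc all_less_Suc)

text \<open>Inside a block of 27 the step is read off \<open>cum\<close>. Between blocks, the
  additional 40 compensates the last entry 40 of \<open>cum\<close>, which leaves the step of
  \<open>tau\<close> at \<open>q < n\<close>.\<close>

lemma tau_step: "tau (Suc n) = tau n + 1 \<or> tau (Suc n) = tau n + 2"
proof (induction n rule: less_induct)
  case (less n)
  define q r where "q = n div 27" and "r = n mod 27"
  have n: "n = 27 * q + r" and r: "r < 27" by (simp_all add: q_def r_def)
  show ?case
  proof (cases "r = 26")
    case True
    have "Suc n = 27 * Suc q + 0" using n True by simp
    then have "tau (Suc n) = 40 * Suc q + tau (Suc q) + cum ! 0" using tau_block[of 0 "Suc q"] by simp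
    moreover have "tau n = 40 * q + tau q + cum ! 26" using tau_block[of 26 q] n True by simp
    moreover have "q < n" using n True by simp
    ultimately show ?thesis using less[of q] by (auto simp: cum_def)
  next
    case False
    with r have r': "r < 26" by simp
    have "Suc n = 27 * q + Suc r" using n by simp
    then have "tau (Suc n) = 40 * q + tau q + cum ! Suc r" using tau_block[of "Suc r" q] r' by simp
    moreover have "tau n = 40 * q + tau q + cum ! r" using tau_block[of r q] n r by simp
    ultimately show ?thesis using cum_step r' by auto
  qed
qed

definition inc :: "nat \<Rightarrow> nat" where "inc n = tau (Suc n) - tau n"

lemma inc_cases: "inc n \<in> {1, 2}" and tau_Suc: "tau (Suc n) = tau n + inc n"
  using tau_step[of n] by (auto simp: inc_def)

definition cum_inc :: "nat list" where
  "cum_inc = [1,1,2,2,1,2,2,2,2,2,1,1,1,2,2,2,2,2,1,2,1,1,1,1,2,1]"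

lemma cum_inc: "\<forall>r<26. cum ! Suc r = cum ! r + cum_inc ! r"
  by (simp add: cum_def cum_inc_def numeral_eq_Suc all_less_Suc)

text \<open>The increments inside a block are the same for every \<open>q\<close>; only the one
  across the border carries information, namely \<open>inc q\<close>.\<close>

lemma inc_block: 
  assumes "x < 53" shows "inc (27 * q + x) = (cum_inc @ inc q # cum_inc) ! x"
proof -
  have len: "length cum_inc = 26" by (simp add: cum_inc_def)
  have low: "inc (27 * q + r) = cum_inc ! r" if "r < 26" for q r
    using tau_block[of "Suc r" q] tau_block[of r q] cum_inc that by (simp add: inc_def)
  consider "x < 26" | "x = 26" | "27 \<le> x" by linarith
  then show ?thesis
  proof cases
    case 1 then show ?thesis using low len by (simp add: nth_append)
  next
    case 2
    have "tau (27 * q + 26) = 40 * q + tau q + 40" using tau_block[of 26 q] by (simp add: cum_def)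
    moreover have "tau (27 * Suc q + 0) = 40 * Suc q + tau (Suc q)" using tau_block[of 0 "Suc q"] by (simp add: cum_def)
    moreover have "inc (27 * q + x) = tau (27 * Suc q + 0) - tau (27 * q + 26)"
      unfolding 2 inc_def by simp
    ultimately have "inc (27 * q + x) = inc q" unfolding tau_Suc by simp
    then show ?thesis using 2 len by (simp add: nth_append)
  next
    case 3
    then have "27 * q + x = 27 * Suc q + (x - 27)" by simp
    then have "inc (27 * q + x) = cum_inc ! (x - 27)" using low[of "x - 27" "Suc q"] assms 3 by simp
    with 3 len show ?thesis by (simp add: nth_append nth_Cons' )
  qed
qed

text \<open>Eight increments starting at residue \<open>r\<close> meet at most one border, so the
  two possible border values \<open>d\<close> cover all windows.\<close>

definition inc_windows :: "(nat list \<times> nat) list" where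
  "inc_windows = concat (map (\<lambda>d. map (\<lambda>r. (take 8 (drop r (cum_inc @ d # cum_inc)), r)) [0..<27]) [1, 2])"

lemma inc_windows_functional: "functional inc_windows"
  by (rule functional_eval, simp add: inc_windows_def cum_inc_def upt_rec drop_Cons' take_Cons')
    (simp cong: agree_weak_cong functional_weak_cong)

text \<open>Nine letters modulo 10 determine eight increments, because 1 and 2 differ modulo 10, and
  the table shows that these determine the residue modulo 27.\<close>

lemma tau_sync:
  assumes "\<And>j. j < 9 \<Longrightarrow> tau (P + j) mod 10 = tau (Q + j) mod 10"
  shows "P mod 27 = Q mod 27"
proof -
  have win: "(map inc [P..<P + 8], P mod 27) \<in> set inc_windows" for P
  proof -
    define q r where "q = P div 27" and "r = P mod 27"
    have n: "P = 27 * q + r" and r: "r < 27" by (simp_all add: q_def r_def)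
    have len: "length cum_inc = 26" by (simp add: cum_inc_def)
    have "map inc [P..<P + 8] = take 8 (drop r (cum_inc @ inc q # cum_inc))"
    proof (rule nth_equalityI)
      fix i assume "i < length (map inc [P..<P + 8])"
      then have i: "i < 8" by simp
      have "inc (27 * q + (r + i)) = (cum_inc @ inc q # cum_inc) ! (r + i)"
        using i r by (intro inc_block) auto
      then show "map inc [P..<P + 8] ! i = take 8 (drop r (cum_inc @ inc q # cum_inc)) ! i"
        using i r len n by (simp add: add.assoc del: take_append drop_append)
    qed (use r len in simp)
    moreover have "inc q \<in> set [1, 2]" using inc_cases[of q] by auto
    ultimately show ?thesis using r unfolding inc_windows_def r_def[symmetric] by force
  qed
  have "inc (P + j) = inc (Q + j)" if "j < 8" for j
  proof -
    have "tau (P + j) mod 10 = tau (Q + j) mod 10" "tau (Suc (P + j)) mod 10 = tau (Suc (Q + j)) mod 10"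
      using assms[of j] assms[of "Suc j"] that by auto
    then have "(tau (P + j) + inc (P + j)) mod 10 = (tau (P + j) + inc (Q + j)) mod 10"
      by (metis tau_Suc mod_add_cong)
    then have "inc (P + j) mod 10 = inc (Q + j) mod 10" by (simp only: mod_add_left_cancel_nat)
    then show ?thesis using inc_cases[of "P + j"] inc_cases[of "Q + j"] by auto
  qed
  then have "map inc [P..<P + 8] = map inc [Q..<Q + 8]" by (intro nth_equalityI) auto
  with win[of P] win[of Q] functional_sound[OF inc_windows_functional] show ?thesis by metis
qed

text \<open>Three consecutive blocks relative to the source value \<open>tau q\<close>, with
  \<open>d\<close> and \<open>e\<close> for the next two source increments.\<close>

definition tau_window :: "nat \<Rightarrow> nat \<Rightarrow> nat list" where
  "tau_window d e = concat (map (\<lambda>a. map (\<lambda>c. (a + c) mod 10) cum) [0, d, d + e])"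

text \<open>The bound 45 admits exactly the distances below 36, since 36 + 36 div 4 = 45.\<close>

lemma tau_window_run_free:
  assumes "d \<in> {1, 2}" "e \<in> {1, 2}"
  shows "run_free 4 45 (tau_window d e)"
proof -
  have "run_free 4 45 (tau_window 1 1)" "run_free 4 45 (tau_window 1 2)" "run_free 4 45 (tau_window 2 1)"
    "run_free 4 45 (tau_window 2 2)"
    by (simp_all add: tau_window_def cum_def cong: no_run_weak_cong no_runs_weak_cong)
  with assms show ?thesis by auto
qed

lemma tau_window:
  assumes "x < 81"
  shows "tau (27 * q + x) mod 10 = (tau q + tau_window (inc q) (inc (Suc q)) ! x) mod 10"
proof -
  have len: "length cum = 27" by (simp add: cum_def)
  have tau: "tau (27 * q + (27 * i + r)) mod 10 = (tau (q + i) + cum ! r) mod 10" if "r < 27" for i r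
  proof -
    have "27 * q + (27 * i + r) = 27 * (q + i) + r" by simp
    then have "tau (27 * q + (27 * i + r)) = 10 * (4 * (q + i)) + (tau (q + i) + cum ! r)"
      using tau_block[OF that, of "q + i"] by (simp add: add.assoc)
    then show ?thesis by (simp only: mod_mult_self4)
  qed
  consider "x < 27" | "27 \<le> x" "x < 54" | "54 \<le> x" by linarith
  then show ?thesis
  proof cases
    case 1 with tau[of x 0] len show ?thesis by (simp add: tau_window_def nth_append mod_simps)
  next
    case 2 
    then have "x = 27 * 1 + (x - 27)" by simp
    with tau[of "x - 27" 1] len 2 show ?thesis by (simp add: tau_window_def nth_append mod_simps tau_Suc add.assoc)
  next
    case 3
    then have "x = 27 * 2 + (x - 54)" by simp
    with tau[of "x - 54" 2] len 3 assms show ?thesis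
      by (simp add: tau_window_def nth_append mod_simps tau_Suc add.assoc numeral_2_eq_2)
  qed
qed

lemma blocks_touched:
  fixes x k L :: nat
  assumes "x div L \<le> b" "b \<le> (x + k) div L" "0 < L"
  obtains j where "j \<le> k" "(x + j) div L = b"
proof (cases "b = x div L")
  case True then show ?thesis using that[of 0] by simp
next
  case False
  with assms have "x div L < b" by simp
  then have "x < b * L" using assms(3) by (simp add: div_less_iff_less_mult)
  moreover have "b * L \<le> x + k" using assms(2,3) by (simp add: less_eq_div_iff_mult_less_eq)
  ultimately show ?thesis using that[of "b * L - x"] assms(3) by simp
qed

text \<open>The \<open>k + 1\<close> positions from \<open>x\<close> to \<open>x + k\<close> lie in
  the blocks counted here, each of which holds \<open>L\<close> positions.\<close>

lemma number_of_blocks_touched: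
  fixes x k L :: nat
  assumes "0 < L"
  shows "k < L * ((x + k) div L - x div L + 1)"
proof -
  have "x + k < L * ((x + k) div L + 1)" "L * (x div L) \<le> x" "x div L \<le> (x + k) div L"
    using assms by (auto simp: dividend_less_times_div div_le_mono mult.commute)
  moreover have "L * ((x + k) div L - x div L + 1) + L * (x div L) = L * ((x + k) div L + 1)"
    using \<open>x div L \<le> (x + k) div L\<close> by (simp flip: distrib_left)
  ultimately show ?thesis by linarith
qed

text \<open>Exponents stay at most 5/4 by descent: a long repetition has a period divisible by 27
  and desubstitutes to one of period \<open>p div 27\<close> whose overlap consists of all touched
  blocks.\<close>

lemma tau_free:
  assumes "1 \<le> p" "\<And>j. j < v \<Longrightarrow> tau (P + j) mod 10 = tau (P + p + j) mod 10"
  shows "4 * v \<le> p"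
  using assms
proof (induction p arbitrary: P v rule: less_induct)
  case (less p)
  show ?case
  proof (rule ccontr)
    assume "\<not> 4 * v \<le> p"
    then have v: "p div 4 < v" by linarith
    \<comment> \<open>Below 36 an offending repetition fits into three blocks. From 36 on,
      \<open>v\<close> is at least 10, so the nine agreements required by \<open>tau_sync\<close>
      are available.\<close>
    show False
    proof (cases "p < 36")
      case True
      define q r where "q = P div 27" and "r = P mod 27"
      have n: "P = 27 * q + r" and r: "r < 27" by (simp_all add: q_def r_def)
      have len: "length (tau_window d e) = 81" for d e by (simp add: tau_window_def cum_def)
      let ?C = "tau_window (inc q) (inc (Suc q))"
      have "run_free 4 45 ?C" using inc_cases by (intro tau_window_run_free) auto
      moreover have "p div 4 < 9" using True by (intro less_mult_imp_div_less) simp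
      ultimately have p4: "p + p div 4 < 45" and "r + p + p div 4 < 81" using True r by auto
      from run_free_sound[OF \<open>run_free 4 45 ?C\<close> less.prems(1) p4, of r] this(2) len
      obtain j where j: "j \<le> p div 4" "?C ! (r + j) \<noteq> ?C ! (r + p + j)" by auto
      have lt: "?C ! x < 10" if "x < 81" for x
        using nth_mem[of x ?C] that len by (auto simp: tau_window_def)
      have "tau (P + j) mod 10 = tau (P + p + j) mod 10" using less.prems(2)[of j] j(1) v by simp
      then have "(tau q + ?C ! (r + j)) mod 10 = (tau q + ?C ! (r + p + j)) mod 10"
        using tau_window[of "r + j" q] tau_window[of "r + p + j" q] n r True j(1) by (simp add: add.assoc)
      then have "?C ! (r + j) mod 10 = ?C ! (r + p + j) mod 10"
        by (simp only: mod_add_left_cancel_nat)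
      with lt j True r show False by auto
    next
      case False
      then have "P mod 27 = (P + p) mod 27" using v less.prems(2) by (intro tau_sync) auto
      then have "27 dvd p" by (metis mod_eq_dvd_iff_nat add_diff_cancel_left' le_add1)
      then obtain p' where p: "p = 27 * p'" by blast
      let ?b = "P div 27" and ?v = "(P + (v - 1)) div 27 - P div 27 + 1"
      have "4 * ?v \<le> p'"
      proof (rule less.IH)
        show "p' < p" "1 \<le> p'" using p less.prems(1) by auto
      next
        fix i assume i: "i < ?v"
        then have "P div 27 \<le> ?b + i" "?b + i \<le> (P + (v - 1)) div 27" by auto
        then obtain j where j: "j \<le> v - 1" "(P + j) div 27 = ?b + i"
          using blocks_touched[of P 27 "?b + i" "v - 1"] by auto
        define r where "r = (P + j) mod 27"
        have Pj: "P + j = 27 * (?b + i) + r" using j(2) by (metis mult_div_mod_eq r_def)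
        then have Pj': "P + p + j = 27 * (?b + p' + i) + r" using p by simp
        have "r < 27" by (simp add: r_def)
        have "tau (P + j) mod 10 = tau (P + p + j) mod 10" using less.prems(2)[of j] j(1) v by simp
        \<comment> \<open>One agreeing position per block suffices: the multiples of 40 vanish
          modulo 10 and the common summand \<open>cum ! r\<close> cancels.\<close>
        then have "(10 * (4 * (?b + i)) + (tau (?b + i) + cum ! r)) mod 10
            = (10 * (4 * (?b + p' + i)) + (tau (?b + p' + i) + cum ! r)) mod 10"
          unfolding Pj Pj' tau_block[OF \<open>r < 27\<close>] by (simp add: add.assoc)
        then have "(tau (?b + i) + cum ! r) mod 10 = (tau (?b + p' + i) + cum ! r) mod 10"
          by (simp only: mod_mult_self4)
        then have "(cum ! r + tau (?b + i)) mod 10 = (cum ! r + tau (?b + p' + i)) mod 10"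
          by (simp only: add.commute)
        then show "tau (?b + i) mod 10 = tau (?b + p' + i) mod 10"
          by (simp only: mod_add_left_cancel_nat)
      qed
      moreover have "v - 1 < 27 * ?v" by (rule number_of_blocks_touched) simp
      ultimately show False using v p by linarith
    qed
  qed
qed

text \<open>Distance 4, which \<open>tau_free\<close> still allows, is impossible because four
  increments add up to between 4 and 8. This sharper bound serves overlaps within a single
  block.\<close>

lemma tau_free_gap: 
  assumes "1 \<le> p" "tau P mod 10 = tau (P + p) mod 10" shows "5 \<le> p"
proof (rule ccontr)
  assume "\<not> 5 \<le> p"
  moreover have "4 * 1 \<le> p" using tau_free[of p 1 P] assms by simp
  ultimately have "p = Suc (Suc (Suc (Suc 0)))" by simp
  then have "(tau P + 0) mod 10
      = (tau P + (inc P + (inc (Suc P) + (inc (Suc (Suc P)) + inc (Suc (Suc (Suc P))))))) mod 10"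
    using assms(2) by (simp add: tau_Suc add.assoc)
  then have "(inc P + (inc (Suc P) + (inc (Suc (Suc P)) + inc (Suc (Suc (Suc P)))))) mod 10 = 0"
    by (simp only: mod_add_left_cancel_nat)
  then show False
    using inc_cases[of P] inc_cases[of "Suc P"] inc_cases[of "Suc (Suc P)"] inc_cases[of "Suc (Suc (Suc P))"]
    by (auto dest: dvd_imp_le)
qed

section \<open>The circular word and its windows\<close>

text \<open>
  A position of the circular word is described by a triple: (0, a, j) and (1, a, j) stand for
  letter j of g(a) and of h(a), and (2, i, 0) stands for letter i of the bridge, counted from 0.
\<close>

definition blocks :: "nat \<Rightarrow> nat list \<Rightarrow> (nat \<times> nat \<times> nat) list" where
  "blocks t as = concat (map (\<lambda>a. map (\<lambda>j. (t, a, j)) [0..<8]) as)"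

definition bridge :: "nat list \<Rightarrow> (nat \<times> nat \<times> nat) list" where
  "bridge X = map (\<lambda>i. (2, i, 0)) [0..<length X]"

text \<open>
  The images commute with shifting: replacing a by a + 2 adds 1 modulo 5 to all letters. So all checks
  can be restricted to contexts that start with the letter 0 or 1.
\<close>

definition block_image :: "nat \<Rightarrow> nat \<Rightarrow> nat list" where
  "block_image t a = (if t = 0 then (if even a then [0,4,3,1,4,2,3,4] else [0,1,2,0,4,3,2,4])
     else (if even a then [0,3,1,2,0,4,1,3] else [1,2,3,0,4,2,1,4]))"

text \<open>For blocks, the parity of \<open>a\<close> selects the image and \<open>a div 2\<close>
  counts modulo 5. So only \<open>a\<close> modulo 10 matters, and tags can keep the unreduced
  values of \<open>tau\<close>.\<close>

fun letter :: "nat list \<Rightarrow> nat \<times> nat \<times> nat \<Rightarrow> nat" where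
  "letter X (t, a, j) = (if t < 2 then (block_image t a ! j + a div 2) mod 5 else X ! a)"

definition tags :: "nat \<Rightarrow> nat list \<Rightarrow> (nat \<times> nat \<times> nat) list" where
  "tags m X = blocks 0 (map tau [0..<m]) @ blocks 1 (map tau (rev [0..<m])) @ bridge X"

lemma length_blocks [simp]: "length (blocks t as) = 8 * length as"
  by (induction as) (simp_all add: blocks_def)

lemma length_bridge [simp]: "length (bridge X) = length X"
  by (simp add: bridge_def)

lemma nth_blocks: "j < 8 * length as \<Longrightarrow> blocks t as ! j = (t, as ! (j div 8), j mod 8)"
proof (induction as arbitrary: j)
  case (Cons a as)
  have eq: "blocks t (a # as) = map (\<lambda>j. (t, a, j)) [0..<8] @ blocks t as"
    by (simp add: blocks_def)
  show ?case
  proof (cases "j < 8")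
    case True then show ?thesis unfolding eq by (simp add: nth_append)
  next
    case False
    then obtain j' where "j = 8 + j'" by (metis le_add_diff_inverse linorder_not_less)
    then show ?thesis using Cons unfolding eq by (simp add: nth_append)
  qed
qed simp

lemma length_tags [simp]: "length (tags m X) = 16 * m + length X"
  by (simp add: tags_def)

lemma nth_tags:
  shows "i < 8 * m \<Longrightarrow> tags m X ! i = (0, tau (i div 8), i mod 8)"
    and "8 * m \<le> i \<Longrightarrow> i < 16 * m \<Longrightarrow> tags m X ! i = (1, tau (2 * m - 1 - i div 8), i mod 8)"
    and "16 * m \<le> i \<Longrightarrow> i < 16 * m + length X \<Longrightarrow> tags m X ! i = (2, i - 16 * m, 0)"
proof -
  show "i < 8 * m \<Longrightarrow> tags m X ! i = (0, tau (i div 8), i mod 8)"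
    by (simp add: tags_def nth_append nth_blocks less_mult_imp_div_less)
next
  assume i: "8 * m \<le> i" "i < 16 * m"
  then obtain x where x: "i = 8 * m + x" by (metis le_iff_add)
  with i have "x div 8 < m" by (simp add: less_mult_imp_div_less)
  with x i show "tags m X ! i = (1, tau (2 * m - 1 - i div 8), i mod 8)"
    by (simp add: tags_def nth_append nth_blocks rev_nth rev_map[symmetric] del: rev_map)
next
  assume i: "16 * m \<le> i" "i < 16 * m + length X"
  then obtain x where "i = 16 * m + x" by (metis le_iff_add)
  with i show "tags m X ! i = (2, i - 16 * m, 0)"
    by (simp add: tags_def nth_append bridge_def)
qed

text \<open>The four surroundings of a short window: inside either half, at the turning point, where
  the reversal makes both sides use the same sources, and around the bridge. The extra block in the
  first two allows for a start inside a block.\<close>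

inductive_set contexts :: "nat \<Rightarrow> nat list \<Rightarrow> (nat \<times> nat \<times> nat) list set" for k X where
  "blocks 0 (map tau [q..<Suc (q + k)]) \<in> contexts k X"
| "blocks 1 (map tau (rev [q..<Suc (q + k)])) \<in> contexts k X"
| "blocks 0 (map tau [q..<q + k]) @ blocks 1 (map tau (rev [q..<q + k])) \<in> contexts k X"
| "blocks 1 (map tau (rev [0..<k])) @ bridge X @ blocks 0 (map tau [0..<k]) \<in> contexts k X"

text \<open>The start \<open>i\<close> decides which kind of context contains the window; a window
  that begins near the end wraps around through the bridge.\<close>

lemma window:
  assumes "k \<le> m" "l \<le> 8 * k" "i < length (tags m X)"
  obtains C r where "C \<in> contexts k X" "r + l \<le> length C"
    "\<And>x. x < l \<Longrightarrow> tags m X ! ((i + x) mod length (tags m X)) = C ! (r + x)"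
proof -
  let ?n = "length (tags m X)"
  have eq: "(8 * a + b) div 8 = a + b div 8" "(8 * a + b) mod 8 = b mod 8" for a b :: nat
    by simp_all
  consider (a) "i + l \<le> 8 * m" | (b) "i < 8 * m" "8 * m < i + l"
    | (c) "8 * m \<le> i" "i + 8 * k < 16 * m" | (d) "16 * m \<le> i + 8 * k" "8 * m \<le> i" by linarith
  then show ?thesis
  proof cases
    case a
    let ?q = "i div 8" and ?r = "i mod 8"
    show ?thesis
    \<comment> \<open>The context may reach beyond the first half, but
      \<open>i + l \<le> 8 * m\<close> confines the positions that are compared.\<close>
    proof (rule that[OF contexts.intros(1), of ?r ?q])
      have "?r < 8" by simp
      then show *: "?r + l \<le> length (blocks 0 (map tau [?q..<Suc (?q + k)]))" using assms(2) by simp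
      fix x assume x: "x < l"
      have "i + x = 8 * ?q + (?r + x)" by simp
      then have "(i + x) div 8 = ?q + (?r + x) div 8" "(i + x) mod 8 = (?r + x) mod 8"
        by (metis add.commute div_mult_self4 zero_neq_numeral, metis mod_mult_self4)
      moreover have "?r + x < 8 * Suc k" using * x by simp
      moreover from this have "(?r + x) div 8 < Suc k" by (intro less_mult_imp_div_less) simp
      moreover have "i + x < 8 * m" using a x by simp
      ultimately show "tags m X ! ((i + x) mod ?n) = blocks 0 (map tau [?q..<Suc (?q + k)]) ! (?r + x)"
        by (simp add: nth_tags nth_blocks del: upt_Suc)
    qed
  next
    case b
    obtain q where q: "m = q + k" using assms(1) by (metis le_iff_add add.commute)
    have "8 * q \<le> i" using b assms(2) q by linarith
    then obtain r where r: "i = 8 * q + r" by (metis le_iff_add)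
    let ?A = "blocks 0 (map tau [q..<q + k])" and ?B = "blocks 1 (map tau (rev [q..<q + k]))"
    show ?thesis
    proof (rule that[OF contexts.intros(3), of r q])
      show *: "r + l \<le> length (?A @ ?B)" using assms(2) b q r by simp
      fix x assume x: "x < l"
      have d: "(i + x) div 8 = q + (r + x) div 8" "(i + x) mod 8 = (r + x) mod 8"
        unfolding r by (simp_all add: add.assoc)
      have n: "i + x < 16 * m" using x b(1) assms(1,2) by linarith
      show "tags m X ! ((i + x) mod ?n) = (?A @ ?B) ! (r + x)"
      proof (cases "r + x < 8 * k")
        case True
        then have "i + x < 8 * m" "(r + x) div 8 < k"
          using q r by (simp, intro less_mult_imp_div_less, simp)
        then show ?thesis using True d n by (simp add: nth_append nth_tags nth_blocks)
      next
        case False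
        then obtain z where z: "r + x = 8 * k + z" by (metis le_iff_add linorder_not_less)
        have z': "z < 8 * k" using * x z by simp
        then have zk: "z div 8 < k" by (simp add: less_mult_imp_div_less)
        have "8 * m \<le> i + x" using False q r by simp
        then have "tags m X ! ((i + x) mod ?n) = (1, tau (2 * m - 1 - (i + x) div 8), (i + x) mod 8)"
          using n by (simp add: nth_tags)
        also have "\<dots> = (1, tau (q + k - Suc (z div 8)), z mod 8)"
          unfolding d z q using zk by (simp add: add.commute)
        also have "\<dots> = ?B ! z"
          using z' zk by (simp add: nth_blocks rev_nth)
        finally show ?thesis using z by (simp add: nth_append)
      qed
    qed
  next
    case c
    let ?r = "i mod 8"
    have "i div 8 + k < 2 * m" using c(2) by linarith
    then obtain q where q: "2 * m = Suc (i div 8 + k + q)" by (metis less_iff_Suc_add)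
    show ?thesis
    proof (rule that[OF contexts.intros(2), of ?r q])
      have "?r < 8" by simp
      then show *: "?r + l \<le> length (blocks 1 (map tau (rev [q..<Suc (q + k)])))" using assms(2) by simp
      fix x assume x: "x < l"
      have "i + x = 8 * (i div 8) + (?r + x)" by simp
      then have d: "(i + x) div 8 = i div 8 + (?r + x) div 8" "(i + x) mod 8 = (?r + x) mod 8"
        by (metis add.commute div_mult_self4 zero_neq_numeral, metis mod_mult_self4)
      have r: "?r + x < 8 * Suc k" using * x by simp
      then have "(?r + x) div 8 < Suc k" by (intro less_mult_imp_div_less) simp
      moreover have "i + x < 16 * m" "8 * m \<le> i + x" using c x assms(2) by auto
      then have "tags m X ! ((i + x) mod ?n) = (1, tau (2 * m - 1 - (i + x) div 8), (i + x) mod 8)"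
        by (simp add: nth_tags)
      ultimately show "tags m X ! ((i + x) mod ?n) = blocks 1 (map tau (rev [q..<Suc (q + k)])) ! (?r + x)"
        unfolding d q using r by (simp add: nth_blocks rev_nth add.commute[of k q] del: upt_Suc)
    qed
  next
    case d
    obtain q where q: "m = q + k" using assms(1) by (metis le_iff_add add.commute)
    have "8 * (2 * q + k) \<le> i" using d(1) unfolding q by simp
    then obtain r where r: "i = 8 * (2 * q + k) + r" by (metis le_iff_add)
    let ?A = "blocks 1 (map tau (rev [0..<k]))" and ?B = "bridge X" and ?C = "blocks 0 (map tau [0..<k])"
    show ?thesis
    proof (rule that[OF contexts.intros(4), of r])
      show *: "r + l \<le> length (?A @ ?B @ ?C)" using assms(2,3) q r by simp
      fix x assume x: "x < l"
      have d': "(i + x) div 8 = 2 * q + k + (r + x) div 8" "(i + x) mod 8 = (r + x) mod 8"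
        using eq[of "2 * q + k" "r + x"] unfolding r by (simp_all only: add.assoc)
      consider "r + x < 8 * k" | "8 * k \<le> r + x" "r + x < 8 * k + length X"
        | "8 * k + length X \<le> r + x"
        by linarith
      then show "tags m X ! ((i + x) mod ?n) = (?A @ ?B @ ?C) ! (r + x)"
      proof cases
        case 1
        then have rk: "(r + x) div 8 < k" by (intro less_mult_imp_div_less) simp
        have "i + x < 16 * m" using 1 q r by simp
        moreover have "8 * m \<le> i + x" using d by simp
        ultimately have "tags m X ! ((i + x) mod ?n) = (1, tau (2 * m - 1 - (i + x) div 8), (i + x) mod 8)"
          by (simp add: nth_tags)
        also have "\<dots> = (1, tau (k - Suc ((r + x) div 8)), (r + x) mod 8)"
          unfolding d' q using rk by simp
        finally show ?thesis using 1 rk by (simp add: nth_append nth_blocks rev_nth)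
      next
        case 2
        then obtain z where z: "r + x = 8 * k + z" by (metis le_iff_add)
        then have "i + x = 16 * m + z" using q r by simp
        with 2 z show ?thesis by (simp add: nth_append nth_tags bridge_def)
      next
        case 3
        then obtain z where z: "r + x = 8 * k + length X + z" by (metis le_iff_add)
        have z': "z < 8 * k" using * x z by simp
        then have "z div 8 < k" by (intro less_mult_imp_div_less) simp
        \<comment> \<open>The window has passed the end of the circular word and continues in the
          first blocks.\<close>
        have "i + x = ?n + z" using z q r by simp
        moreover have "z < ?n" "z < 8 * m" using z' assms(1) by auto
        ultimately have "tags m X ! ((i + x) mod ?n) = (0, tau (z div 8), z mod 8)"
          by (simp only: mod_add_self1 mod_less nth_tags)
        then show ?thesis unfolding z using z' \<open>z div 8 < k\<close>
          by (simp add: nth_append nth_blocks)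
      qed
    qed
  qed
qed

text \<open>All candidates for \<open>k + 1\<close> consecutive values of \<open>tau\<close>
  relative to the first, given that each increment is 1 or 2.\<close>

fun incs :: "nat \<Rightarrow> nat list list" where
  "incs 0 = [[0]]"
| "incs (Suc k) = concat (map (\<lambda>e. [0 # map ((+) 1) e, 0 # map ((+) 2) e]) (incs k))"

lemma map_tau_upt: "\<exists>e\<in>set (incs k). map tau [q..<Suc (q + k)] = map ((+) (tau q)) e"
proof (induction k arbitrary: q)
  case (Suc k)
  obtain e where e: "e \<in> set (incs k)" "map tau [Suc q..<Suc (Suc q + k)] = map ((+) (tau (Suc q))) e"
    using Suc.IH by blast
  have "map tau [q..<Suc (q + Suc k)] = tau q # map tau [Suc q..<Suc (Suc q + k)]"
    by (subst upt_conv_Cons) simp_all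
  also have "\<dots> = map ((+) (tau q)) (0 # map ((+) (inc q)) e)"
    unfolding e(2) tau_Suc by (simp add: add.assoc)
  finally show ?case using e(1) inc_cases[of q] by auto
qed simp

fun shift :: "nat \<Rightarrow> nat \<times> nat \<times> nat \<Rightarrow> nat \<times> nat \<times> nat" where
  "shift s (t, a, j) = (t, a + 2 * s, j)"

lemma blocks_shift: "blocks t (map ((+) (b + 2 * s)) e) = map (shift s) (blocks t (map ((+) b) e))"
  by (simp add: blocks_def map_concat o_def add_ac)

text \<open>Representatives up to shifting: \<open>b\<close> is the smallest source value, reduced
  to its parity. The turning point has one source fewer, hence \<open>k - 1\<close>.\<close>

definition base_contexts :: "nat \<Rightarrow> (nat \<times> nat \<times> nat) list list" where
  "base_contexts k = concat (map (\<lambda>b.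
      map (\<lambda>e. blocks 0 (map ((+) b) e)) (incs k) @
      map (\<lambda>e. blocks 1 (map ((+) b) (rev e))) (incs k) @
      map (\<lambda>e. blocks 0 (map ((+) b) e) @ blocks 1 (map ((+) b) (rev e))) (incs (k - 1))) [0, 1])"

definition bridge_context :: "nat \<Rightarrow> nat list \<Rightarrow> (nat \<times> nat \<times> nat) list" where
  "bridge_context k X = blocks 1 (rev [0..<k]) @ bridge X @ blocks 0 [0..<k]"

text \<open>Writing \<open>tau q\<close> as \<open>b + 2 * s\<close> with \<open>b\<close> its
  parity moves everything but \<open>b\<close> and the increments into the shift. The bridge context
  has fixed sources and is not normalized.\<close>

lemma contexts_cases:
  assumes "C \<in> contexts k X" "1 \<le> k" "k \<le> 3"
  shows "C = bridge_context k X \<or> (\<exists>s. \<exists>D\<in>set (base_contexts k). C = map (shift s) D)"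
proof -
  have base: "\<exists>b s. tau q = b + 2 * s \<and> b \<in> set [0, 1]" for q
    by (rule exI[of _ "tau q mod 2"], rule exI[of _ "tau q div 2"]) auto
  from assms(1) show ?thesis
  proof cases
    case (1 q)
    obtain e where e: "e \<in> set (incs k)" "map tau [q..<Suc (q + k)] = map ((+) (tau q)) e"
      using map_tau_upt by blast
    obtain b s where b: "tau q = b + 2 * s" "b \<in> set [0, 1]" using base by blast
    have "C = map (shift s) (blocks 0 (map ((+) b) e))" using 1 e(2) b(1) blocks_shift by simp
    moreover have "blocks 0 (map ((+) b) e) \<in> set (base_contexts k)"
      using e(1) b(2) unfolding base_contexts_def by auto
    ultimately show ?thesis by blast
  next
    case (2 q)
    obtain e where e: "e \<in> set (incs k)" "map tau [q..<Suc (q + k)] = map ((+) (tau q)) e"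
      using map_tau_upt by blast
    obtain b s where b: "tau q = b + 2 * s" "b \<in> set [0, 1]" using base by blast
    have "C = map (shift s) (blocks 1 (map ((+) b) (rev e)))"
      unfolding 2 rev_map[symmetric] e(2) b(1) unfolding rev_map blocks_shift ..
    moreover have "blocks 1 (map ((+) b) (rev e)) \<in> set (base_contexts k)"
      using e(1) b(2) unfolding base_contexts_def by auto
    ultimately show ?thesis by blast
  next
    case (3 q)
    obtain e where e: "e \<in> set (incs (k - 1))" "map tau [q..<q + k] = map ((+) (tau q)) e"
      using map_tau_upt[of "k - 1" q] assms(2) by auto
    obtain b s where b: "tau q = b + 2 * s" "b \<in> set [0, 1]" using base by blast
    have "C = map (shift s) (blocks 0 (map ((+) b) e) @ blocks 1 (map ((+) b) (rev e)))"
      unfolding 3 rev_map[symmetric] e(2) b(1) unfolding rev_map blocks_shift map_append ..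
    moreover have "blocks 0 (map ((+) b) e) @ blocks 1 (map ((+) b) (rev e)) \<in> set (base_contexts k)"
      using e(1) b(2) unfolding base_contexts_def by auto
    ultimately show ?thesis by blast
  next
    case 4
    \<comment> \<open>\<open>cum\<close> begins with 0, 1, 2, 4, so \<open>tau\<close> is the
      identity exactly on the range that \<open>k \<le> 3\<close> requires.\<close>
    have "tau i = i" if "i < 3" for i
      using that tau_block[of i 0] by (auto simp: tau_0 cum_def numeral_3_eq_3 less_Suc_eq)
    then have "map tau [0..<k] = [0..<k]" using assms(3) by (intro map_idI) auto
    then show ?thesis unfolding 4 bridge_context_def by (simp add: rev_map[symmetric])
  qed
qed

section \<open>The bridges and the finite checks on contexts\<close>

definition bridges :: "nat list list" where
  "bridges = [
    [0,2,3,1,0,4,2,0,1,3],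
    [4,2,3,1,2,4,3,2,1,0,2,3],
    [2,4,0,3,4,2,1,4,3,0,1,3,4,1],
    [2,4,3,0,4,2,1,3,4,0,2,4,1,3,2,1],
    [0,1,4,0,2,4,1,0,3,4,2,3,1,2,4,0,2,1],
    [0,1,4,0,2,4,1,0,3,4,2,1,4,3,2,0,1,2,4,1],
    [0,1,4,0,2,3,4,2,0,3,2,1,4,0,1,3,4,2,1,0,2,3],
    [4,2,1,0,3,2,0,4,3,1,4,0,3,4,2,0,4,1,3,2,4,0,2,3]]"

lemma incs_numeral:
  "incs 1 = [[0,1],[0,2]]"
  "incs 2 = [[0,1,2],[0,2,3],[0,1,3],[0,2,4]]"
  "incs 3 = [[0,1,2,3],[0,2,3,4],[0,1,3,4],[0,2,4,5],[0,1,2,4],[0,2,3,5],[0,1,3,5],[0,2,4,6]]"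
  by (simp_all add: numeral_2_eq_2 numeral_3_eq_3)

lemmas eval_contexts = base_contexts_def bridge_context_def bridge_def bridges_def incs_numeral
  blocks_def block_image_def upt_rec

text \<open>The bound 23 admits exactly the distances up to 17. From 18 on an offending overlap has
  at least seven letters, and six-letter windows can be used instead.\<close>

lemma base_run_free: "list_all (\<lambda>C. run_free 3 23 (map (letter []) C)) (base_contexts 3)"
  by (simp add: eval_contexts cong: no_run_weak_cong no_runs_weak_cong)

definition bridge_run_free :: "nat list \<Rightarrow> bool" where
  "bridge_run_free X = run_free 3 23 (map (letter X) (bridge_context 3 X))"

lemma bridges_run_free: "list_all bridge_run_free bridges"
  by (simp add: bridge_run_free_def eval_contexts cong: no_run_weak_cong no_runs_weak_cong)

text \<open>The factor 4 is -1 modulo 5, so the base 5 digits of the code are the differences to the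
  first letter.\<close>

definition window_code :: "nat list \<Rightarrow> nat" where
  "window_code w = foldr (\<lambda>x c. (x + 4 * hd w) mod 5 + 5 * c) w 0"

text \<open>
  A window of six letters is identified with its differences to the first letter, and the description
  of its third letter is made relative to the first letter in the same way; both are invariant
  under shifting.
\<close>

fun relative :: "nat \<Rightarrow> nat \<times> nat \<times> nat \<Rightarrow> nat \<times> nat \<times> nat" where
  "relative x (t, a, j) = (if t < 2 then (t, (a + 8 * x) mod 10, j) else (t, a, x))"

fun entries :: "nat list \<Rightarrow> (nat \<times> nat \<times> nat) list \<Rightarrow> (nat \<times> nat \<times> nat \<times> nat) list" where
  "entries (x # xs) C = (if length xs < 5 then []
     else (window_code (take 6 (x # xs)), relative x (C ! 2)) # entries xs (tl C))"
| "entries [] C = []"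

lemma entries_nth:
  "r + 6 \<le> length xs \<Longrightarrow> length C = length xs \<Longrightarrow>
    (window_code (take 6 (drop r xs)), relative (xs ! r) (C ! (r + 2))) \<in> set (entries xs C)"
proof (induction xs C arbitrary: r rule: entries.induct)
  case (1 x xs C)
  show ?case
  proof (cases r)
    case 0 with 1 show ?thesis by (simp add: numeral_2_eq_2)
  next
    case (Suc r')
    moreover have "tl C ! (r' + 2) = C ! (Suc r' + 2)" using 1(3) by (cases C) auto
    ultimately show ?thesis using 1(1)[of r'] 1(2,3) by auto
  qed
qed simp

definition context_entries :: "nat list \<Rightarrow> (nat \<times> nat \<times> nat) list \<Rightarrow> (nat \<times> nat \<times> nat \<times> nat) list" where
  "context_entries X C = entries (map (letter X) C) C"

definition base_entries :: "(nat \<times> nat \<times> nat \<times> nat) list" where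
  "base_entries = concat (map (context_entries []) (base_contexts 1))"

\<comment> \<open>Evaluates the large table once, to a literal that both following checks
  use.\<close>
schematic_goal base_entries_eq: "base_entries = ?E"
  by (simp add: base_entries_def context_entries_def window_code_def eval_contexts take_Cons')

lemma base_entries_functional: "functional base_entries"
  unfolding base_entries_eq by (simp cong: agree_weak_cong functional_weak_cong)

text \<open>Comparing each bridge table with the base table separately lets the base table be tested
  against itself only once, not once per bridge.\<close>

definition bridge_entries_agree :: "nat list \<Rightarrow> bool" where
  "bridge_entries_agree X = list_all (\<lambda>(k, v). agree k v base_entries) (context_entries X (bridge_context 1 X))"

lemma bridges_entries_agree: "list_all bridge_entries_agree bridges"
  unfolding bridges_def
  by (simp add: bridge_entries_agree_def[unfolded base_entries_eq] context_entries_def window_code_def eval_contexts take_Cons' cong: agree_weak_cong)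

text \<open>A copy of \<open>functional\<close> that \<open>functional_weak_cong\<close> does not
  freeze, so that the simplifier first evaluates the table below it.\<close>

fun functional_list :: "('a \<times> 'b) list \<Rightarrow> bool" where
  "functional_list [] = True"
| "functional_list (x # xs) = functional (x # xs)"

definition bridge_entries_functional :: "nat list \<Rightarrow> bool" where
  "bridge_entries_functional X = functional_list (context_entries X (bridge_context 1 X))"

lemma bridges_entries_functional: "list_all bridge_entries_functional bridges"
  by (simp add: bridge_entries_functional_def context_entries_def window_code_def eval_contexts take_Cons'
    cong: agree_weak_cong functional_weak_cong)

section \<open>Synchronization\<close>

text \<open>Adding \<open>2 * s\<close> keeps the parity, hence the image, and adds \<open>s\<close>
  to the half.\<close>

lemma letter_shift:
  "t < 2 \<Longrightarrow> letter X (shift s (t, a, j)) = (letter [] (t, a, j) + s) mod 5"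
  by (simp add: block_image_def mod_simps add_ac)

lemma base_contexts_fst: "D \<in> set (base_contexts k) \<Longrightarrow> x \<in> set D \<Longrightarrow> fst x < 2"
  by (auto simp: base_contexts_def blocks_def)

lemma letter_shift_base:
  assumes "D \<in> set (base_contexts k)" "r < length D"
  shows "letter X (map (shift s) D ! r) = (letter [] (D ! r) + s) mod 5"
proof -
  obtain t a j where "D ! r = (t, a, j)" by (cases "D ! r")
  moreover from this have "t < 2" using base_contexts_fst[OF assms(1) nth_mem[OF assms(2)]] by simp
  ultimately show ?thesis using letter_shift assms(2) by simp
qed

lemma letter_base_less:
  assumes "D \<in> set (base_contexts k)" "r < length D"
  shows "letter [] (D ! r) < 5"
proof -
  obtain t a j where "D ! r = (t, a, j)" by (cases "D ! r")
  moreover from this have "t < 2" using base_contexts_fst[OF assms(1) nth_mem[OF assms(2)]] by simp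
  ultimately show ?thesis by simp
qed

text \<open>Shifting adds the same \<open>s\<close> modulo 5 to all letters, so a mismatch in a base
  context persists.\<close>

lemma context_run_free:
  assumes "X \<in> set bridges" "C \<in> contexts 3 X" "1 \<le> p" "p + p div 3 < 23" "r + p + p div 3 < length C"
  shows "\<exists>j\<le>p div 3. letter X (C ! (r + j)) \<noteq> letter X (C ! (r + p + j))"
  using contexts_cases[OF assms(2) one_le_numeral order_refl]
proof (elim disjE exE bexE)
  assume C: "C = bridge_context 3 X"
  have "run_free 3 23 (map (letter X) C)"
    using assms(1) bridges_run_free unfolding C by (simp add: list_all_iff bridge_run_free_def)
  from run_free_sound[OF this assms(3,4), of r] assms(5)
  obtain j where "j \<le> p div 3" "map (letter X) C ! (r + j) \<noteq> map (letter X) C ! (r + p + j)" by auto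
  with assms(5) show ?thesis by (intro exI[of _ j]) auto
next
  fix s D assume D: "D \<in> set (base_contexts 3)" and C: "C = map (shift s) D"
  have "run_free 3 23 (map (letter []) D)" using D base_run_free by (simp add: list_all_iff)
  from run_free_sound[OF this assms(3,4), of r] assms(5) C
  obtain j where j: "j \<le> p div 3" "map (letter []) D ! (r + j) \<noteq> map (letter []) D ! (r + p + j)" by auto
  have l: "r + j < length D" "r + p + j < length D" using j(1) assms(5) C by auto
  have "letter X (C ! (r + j)) \<noteq> letter X (C ! (r + p + j))"
  proof
    assume "letter X (C ! (r + j)) = letter X (C ! (r + p + j))"
    then have "(s + letter [] (D ! (r + j))) mod 5 = (s + letter [] (D ! (r + p + j))) mod 5"
      unfolding C letter_shift_base[OF D l(1)] letter_shift_base[OF D l(2)] by (simp add: add.commute)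
    then have "letter [] (D ! (r + j)) mod 5 = letter [] (D ! (r + p + j)) mod 5"
      by (simp only: mod_add_left_cancel_nat)
    with letter_base_less[OF D l(1)] letter_base_less[OF D l(2)] j l show False by simp
  qed
  with j(1) show ?thesis by blast
qed

lemma window_code_shift: 
  assumes "w \<noteq> []" shows "window_code (map (\<lambda>x. (x + s) mod 5) w) = window_code w"
proof -
  have "((x + s) mod 5 + 4 * ((y + s) mod 5)) mod 5 = (x + 4 * y) mod 5" for x y :: nat
  proof -
    have "((x + s) mod 5 + 4 * ((y + s) mod 5)) mod 5 = (x + s + 4 * (y + s)) mod 5"
      by (intro mod_add_cong mod_mult_right_eq mod_mod_trivial)
    also have "x + s + 4 * (y + s) = 5 * s + (x + 4 * y)" by simp
    finally show ?thesis by (simp only: mod_mult_self4)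
  qed
  then show ?thesis using assms by (simp add: window_code_def foldr_map o_def hd_map)
qed

text \<open>\<open>8 * y\<close> stands for \<open>- 2 * y\<close> modulo 10, which cancels the
  source shift \<open>2 * s\<close> that accompanies a letter shift by \<open>s\<close>.\<close>

lemma relative_shift:
  assumes "fst x < 2" shows "relative ((y + s) mod 5) (shift s x) = relative y x"
proof -
  obtain t a j where x: "x = (t, a, j)" by (cases x)
  have "y + s = 5 * ((y + s) div 5) + (y + s) mod 5" by simp
  then have "10 * s + (a + 8 * y) = 10 * (4 * ((y + s) div 5)) + (a + 2 * s + 8 * ((y + s) mod 5))"
    by linarith
  then have "(a + 8 * y) mod 10 = (a + 2 * s + 8 * ((y + s) mod 5)) mod 10" by (metis mod_mult_self4)
  with x assms show ?thesis by simp
qed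

definition all_entries :: "nat list \<Rightarrow> (nat \<times> nat \<times> nat \<times> nat) list" where
  "all_entries X = context_entries X (bridge_context 1 X) @ base_entries"

lemma functional_append:
  "functional xs \<Longrightarrow> functional ys \<Longrightarrow> \<forall>(k, v)\<in>set xs. agree k v ys \<Longrightarrow> functional (xs @ ys)"
  by (induction xs rule: functional.induct) (auto simp: agree_iff)

lemma functional_list_iff: "functional_list xs = functional xs"
  by (cases xs) auto

lemma all_entries_functional: "X \<in> set bridges \<Longrightarrow> functional (all_entries X)"
  unfolding all_entries_def
  using bridges_entries_functional bridges_entries_agree base_entries_functional
  by (intro functional_append)
    (auto simp: list_all_iff bridge_entries_functional_def bridge_entries_agree_def functional_list_iff)

lemma context_entry:
  assumes "C \<in> contexts 1 X" "r + 6 \<le> length C"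
  shows "(window_code (map (\<lambda>x. letter X (C ! (r + x))) [0..<6]), relative (letter X (C ! r)) (C ! (r + 2)))
    \<in> set (all_entries X)"
proof -
  have win: "take 6 (drop r (map f C)) = map (\<lambda>x. f (C ! (r + x))) [0..<6]" 
    if "r + 6 \<le> length C" for f :: "nat \<times> nat \<times> nat \<Rightarrow> nat" and C
    using that by (intro nth_equalityI) auto
  have entry: "(window_code (map (\<lambda>x. letter X (C ! (r + x))) [0..<6]), relative (letter X (C ! r)) (C ! (r + 2)))
      \<in> set (context_entries X C)" if "r + 6 \<le> length C" for X C
  proof -
    have nth: "map (letter X) C ! r = letter X (C ! r)" using that by simp
    have "(window_code (take 6 (drop r (map (letter X) C))), relative (map (letter X) C ! r) (C ! (r + 2)))
        \<in> set (entries (map (letter X) C) C)"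
      using that by (intro entries_nth) simp_all
    then show ?thesis unfolding context_entries_def nth win[OF that] .
  qed
  from contexts_cases[OF assms(1) order_refl one_le_numeral] show ?thesis
  proof (elim disjE exE bexE)
    assume "C = bridge_context 1 X"
    with entry[OF assms(2)] show ?thesis by (simp add: all_entries_def)
  next
    fix s D assume D: "D \<in> set (base_contexts 1)" and C: "C = map (shift s) D"
    have r: "r + 6 \<le> length D" using assms(2) C by simp
    have lt: "letter X (C ! (r + x)) = (letter [] (D ! (r + x)) + s) mod 5" if "x < 6" for x
      using letter_shift_base[OF D] that r C by simp
    have "map (\<lambda>x. letter X (C ! (r + x))) [0..<6]
        = map (\<lambda>x. (x + s) mod 5) (map (\<lambda>x. letter [] (D ! (r + x))) [0..<6])"
      unfolding map_map by (rule map_cong[OF refl]) (simp add: lt)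
    then have "window_code (map (\<lambda>x. letter X (C ! (r + x))) [0..<6]) = window_code (map (\<lambda>x. letter [] (D ! (r + x))) [0..<6])"
      by (metis window_code_shift map_is_Nil_conv upt_eq_Nil_conv zero_neq_numeral not_numeral_le_zero)
    moreover have "relative (letter X (C ! r)) (C ! (r + 2)) = relative (letter [] (D ! r)) (D ! (r + 2))"
      using lt[of 0] relative_shift[of "D ! (r + 2)" "letter [] (D ! r)" s] base_contexts_fst[OF D, of "D ! (r + 2)"] r C
      by simp
    moreover have "set (context_entries [] D) \<subseteq> set (all_entries X)"
      using D by (auto simp: all_entries_def base_entries_def)
    ultimately show ?thesis using entry[OF r, of "[]"] by auto
  qed
qed

definition similar :: "nat \<times> nat \<times> nat \<Rightarrow> nat \<times> nat \<times> nat \<Rightarrow> bool" where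
  "similar x y \<longleftrightarrow> (\<exists>z. relative z x = relative z y)"

text \<open>Equal windows have the same code, so the functional table gives their third positions
  the same relative description. The common first letter is the witness for
  \<open>similar\<close>.\<close>

lemma sync:
  assumes X: "X \<in> set bridges" and "1 \<le> m" and n: "n = length (tags m X)" and "i < n" "i' < n"
    and eq: "\<And>x. x < 6 \<Longrightarrow> letter X (tags m X ! ((i + x) mod n)) = letter X (tags m X ! ((i' + x) mod n))"
  shows "similar (tags m X ! ((i + 2) mod n)) (tags m X ! ((i' + 2) mod n))"
proof -
  let ?t = "\<lambda>x. tags m X ! (x mod n)"
  have entry: "(window_code (map (\<lambda>x. letter X (?t (i + x))) [0..<6]), relative (letter X (?t i)) (?t (i + 2)))
      \<in> set (all_entries X)" if i: "i < n" for i
  proof -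
    obtain C r where C: "C \<in> contexts 1 X" "r + 6 \<le> length C" "\<And>x. x < 6 \<Longrightarrow> ?t (i + x) = C ! (r + x)"
      using window[of 1 m 6 i X] assms(2) i unfolding n by auto
    have eq: "map (\<lambda>x. letter X (?t (i + x))) [0..<6] = map (\<lambda>x. letter X (C ! (r + x))) [0..<6]"
        "?t i = C ! r" "?t (i + 2) = C ! (r + 2)"
      using C(3) C(3)[of 0] C(3)[of 2] by simp_all
    show ?thesis using context_entry[OF C(1,2)] unfolding eq .
  qed
  have "map (\<lambda>x. letter X (?t (i + x))) [0..<6] = map (\<lambda>x. letter X (?t (i' + x))) [0..<6]"
    using eq by simp
  moreover have "letter X (?t i) = letter X (?t i')" using eq[of 0] by simp
  ultimately show ?thesis
    using entry[OF \<open>i < n\<close>] entry[OF \<open>i' < n\<close>] functional_sound[OF all_entries_functional[OF X]]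
    unfolding similar_def by metis
qed

section \<open>Repetitions within one half\<close>

lemma similar_iff:
  "similar (t, a, j) (t', a', j') \<longleftrightarrow> t = t' \<and> (if t < 2 then a mod 10 = a' mod 10 \<and> j = j' else a = a')"
proof -
  have "(a + 8 * z) mod 10 = (a' + 8 * z) mod 10 \<longleftrightarrow> a mod 10 = a' mod 10" for z
    using mod_add_left_cancel_nat[of "8 * z" a 10 a'] by (simp add: add.commute)
  then show ?thesis by (auto simp: similar_def)
qed

text \<open>Read backwards, a repetition keeps its distance and its length. The index
  \<open>P\<close> is where the reversed reading ends.\<close>

lemma tau_free_rev:
  assumes "1 \<le> p" "b + c + p \<le> Suc N" "\<And>x. x < c \<Longrightarrow> tau (N - (b + x)) mod 10 = tau (N - (b + x + p)) mod 10"
  shows "4 * c \<le> p"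
proof -
  obtain P where P: "Suc N = b + c + p + P" using assms(2) by (metis le_iff_add)
  show ?thesis
  proof (rule tau_free[OF assms(1)])
    fix x assume x: "x < c"
    then have "N - (b + (c - 1 - x)) = P + p + x" "N - (b + (c - 1 - x) + p) = P + x" using P by auto
    then show "tau (P + x) mod 10 = tau (P + p + x) mod 10" using assms(3)[of "c - 1 - x"] x by simp
  qed
qed

lemma length_bridges: "X \<in> set bridges \<Longrightarrow> 10 \<le> length X"
  by (auto simp: bridges_def)

text \<open>Agreement of positions modulo 8 makes \<open>p\<close> a multiple \<open>8 * q\<close>,
  and the \<open>c\<close> touched blocks form an overlap at distance \<open>q\<close> in the
  source. The 6 restores the letters lost to the six-letter windows.\<close>

lemma block_repetition:
  assumes p: "1 \<le> p" and fits: "u + p + k < 8 * m"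
    and \<tau>: "\<tau> = tau \<or> \<tau> = (\<lambda>b. tau (m - 1 - b))"
    and eq: "\<And>y. y \<le> k \<Longrightarrow> (u + y) mod 8 = (u + p + y) mod 8 \<and>
      \<tau> ((u + y) div 8) mod 10 = \<tau> ((u + p + y) div 8) mod 10"
  shows "3 * (k + 6) \<le> p"
proof -
  have "u mod 8 = (u + p) mod 8" using eq[of 0] by simp
  then have "8 dvd p" by (metis add_diff_cancel_left' le_add1 mod_eq_dvd_iff_nat)
  then obtain q where q: "p = 8 * q" by blast
  define b c where "b = u div 8" and "c = (u + k) div 8 - u div 8 + 1"
  have le: "u div 8 \<le> (u + k) div 8" by (simp add: div_le_mono)
  have k: "k < 8 * c" unfolding c_def by (rule number_of_blocks_touched) simp
  have same: "\<tau> (b + x) mod 10 = \<tau> (b + x + q) mod 10" if x: "x < c" for x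
  proof -
    have "u div 8 \<le> b + x" "b + x \<le> (u + k) div 8" using x le by (auto simp: b_def c_def)
    then obtain y where y: "y \<le> k" "(u + y) div 8 = b + x" using blocks_touched[of u 8 "b + x" k] by auto
    have "u + p + y = 8 * q + (u + y)" using q by simp
    then have "(u + p + y) div 8 = b + x + q" using y(2) by simp
    with eq[OF y(1)] y(2) show ?thesis by simp
  qed
  have "(u + p + k) div 8 < m" using fits by (intro less_mult_imp_div_less) simp
  moreover have "(u + p + k) div 8 = b + c - 1 + q"
  proof -
    have "u + p + k = 8 * q + (u + k)" using q by simp
    then have "(u + p + k) div 8 = (u + k) div 8 + q" by simp
    then show ?thesis using le by (simp add: b_def c_def)
  qed
  ultimately have m: "b + c + q \<le> Suc (m - 1)" using k by (cases c) auto
  have q1: "1 \<le> q" using p q by simp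
  have c1: "1 \<le> c" by (simp add: c_def)
  have "4 * c \<le> q \<and> 5 \<le> q"
    using \<tau>
  proof
    assume "\<tau> = tau"
    then show ?thesis using tau_free[OF q1, of c b] tau_free_gap[OF q1, of b] same same[of 0] c1
      by (simp add: ac_simps)
  next
    assume \<tau>: "\<tau> = (\<lambda>b. tau (m - 1 - b))"
    then have "4 * c \<le> q" using same by (intro tau_free_rev[OF q1 m]) simp
    moreover have "m - 1 - (b + q) + q = m - 1 - b" using c1 m by linarith
    then have "tau (m - 1 - (b + q)) mod 10 = tau (m - 1 - (b + q) + q) mod 10"
      using same[of 0] c1 unfolding \<tau> by simp
    then have "5 \<le> q" by (rule tau_free_gap[OF q1])
    ultimately show ?thesis by blast
  qed
  then have c4: "4 * c \<le> q" and q5: "5 \<le> q" by simp_all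
  \<comment> \<open>From \<open>k < 8 * c\<close> the target is at most 24 c + 15. For
    \<open>c \<ge> 2\<close> this follows from \<open>4 * c \<le> q\<close>; for
    \<open>c = 1\<close> it reads 39 \<le> 8 q, which requires \<open>q \<ge> 5\<close>.\<close>
  have "24 * c + 15 \<le> 8 * q"
  proof (cases "c = 1")
    case True then show ?thesis using q5 by simp
  next
    case False
    with c1 have "2 \<le> c" by simp
    with c4 show ?thesis by simp
  qed
  moreover have "3 * (k + 6) \<le> 24 * c + 15" using k by simp
  ultimately show ?thesis unfolding q by (rule order_trans[rotated])
qed

section \<open>Freeness of the circular words\<close>

text \<open>A factor of length \<open>p + l\<close> with period \<open>p\<close> has exponent at
  most 4/3 iff \<open>3 * l \<le> p\<close>. The bound on \<open>p + l\<close> keeps it within one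
  conjugate.\<close>

definition cyclic_free :: "'a list \<Rightarrow> bool" where
  "cyclic_free w \<longleftrightarrow> (\<forall>i p l. i < length w \<longrightarrow> 1 \<le> p \<longrightarrow> p + l \<le> length w \<longrightarrow>
    (\<forall>x<l. w ! ((i + x) mod length w) = w ! ((i + p + x) mod length w)) \<longrightarrow> 3 * l \<le> p)"

text \<open>An offending overlap can be cut to \<open>p div 3 + 1\<close> letters. The repetition
  then spans at most 23 letters and lies in a context with \<open>k = 3\<close>.\<close>

lemma short_period:
  assumes X: "X \<in> set bridges" and m: "3 \<le> m" and n: "n = length (tags m X)"
    and "i < n" "1 \<le> p" "p \<le> 17"
    and eq: "\<And>x. x < l \<Longrightarrow> letter X (tags m X ! ((i + x) mod n)) = letter X (tags m X ! ((i + p + x) mod n))"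
  shows "3 * l \<le> p"
proof (rule ccontr)
  assume "\<not> 3 * l \<le> p"
  then have l: "p div 3 < l" by linarith
  have "p div 3 < 6" using \<open>p \<le> 17\<close> by (intro less_mult_imp_div_less) simp
  then have p3: "p + p div 3 < 23" using \<open>p \<le> 17\<close> by simp
  obtain C r where C: "C \<in> contexts 3 X" "r + 23 \<le> length C"
      "\<And>x. x < 23 \<Longrightarrow> tags m X ! ((i + x) mod n) = C ! (r + x)"
    using window[OF m, of 23 i X] \<open>i < n\<close> unfolding n by auto
  obtain j where j: "j \<le> p div 3" "letter X (C ! (r + j)) \<noteq> letter X (C ! (r + p + j))"
    using context_run_free[OF X C(1) \<open>1 \<le> p\<close> p3, of r] C(2) p3 by auto
  have "letter X (C ! (r + j)) = letter X (C ! (r + (p + j)))"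
    using eq[of j] C(3)[of j] C(3)[of "p + j"] j(1) l p3 by (simp add: add.assoc)
  with j(2) show False by (simp add: add.assoc)
qed

lemma long_period:
  assumes X: "X \<in> set bridges" and m: "1 \<le> m" and n: "n = length (tags m X)"
    and i: "i < n" and p: "18 \<le> p" "p + l \<le> n"
    and eq: "\<And>x. x < l \<Longrightarrow> letter X (tags m X ! ((i + x) mod n)) = letter X (tags m X ! ((i + p + x) mod n))"
  shows "3 * l \<le> p"
proof (rule ccontr)
  assume "\<not> 3 * l \<le> p"
  then have l: "p < 3 * l" by simp
  \<comment> \<open>An overlap of \<open>l\<close> letters contains \<open>k + 1\<close> windows of
    six letters; \<open>u + y\<close> and \<open>v + y\<close> below are their third
    positions.\<close>
  define k where "k = l - 6"
  have lk: "l = k + 6" using l p(1) by (simp add: k_def)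
  have len: "n = 16 * m + length X" "10 \<le> length X" using n length_bridges[OF X] by simp_all
  have pn: "p < n" using p lk by simp
  define u v where "u = (i + 2) mod n" and "v = (i + 2 + p) mod n"
  have u: "u < n" and v: "v < n" using i by (simp_all add: u_def v_def)
  have "v = (u + p) mod n" by (simp add: u_def v_def mod_simps)
  then consider "v = u + p" | "u + p = v + n"
    using u pn by (metis add.commute add_less_mono le_add_diff_inverse linorder_not_less mod_if mod_less nat_add_left_cancel_less)
  note v_cases = this
  have uv: "u \<noteq> v" using v_cases p(1) pn by (cases rule: v_cases) auto
  have sim: "similar (tags m X ! (u + y)) (tags m X ! (v + y))" if y: "y \<le> k" "u + y < n" "v + y < n" for y
  proof -
    let ?i = "(i + y) mod n" and ?j = "(i + p + y) mod n"
    have "similar (tags m X ! ((?i + 2) mod n)) (tags m X ! ((?j + 2) mod n))"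
    proof (rule sync[OF X m n])
      show "?i < n" "?j < n" using i by simp_all
      fix x :: nat assume "x < 6"
      then have "letter X (tags m X ! ((i + (y + x)) mod n)) = letter X (tags m X ! ((i + p + (y + x)) mod n))"
        using y(1) lk by (intro eq) simp
      then show "letter X (tags m X ! ((?i + x) mod n)) = letter X (tags m X ! ((?j + x) mod n))"
        by (simp add: mod_simps add.assoc)
    qed
    moreover have "(?i + 2) mod n = (u + y) mod n" "(?j + 2) mod n = (v + y) mod n"
      by (simp_all add: u_def v_def mod_simps add_ac)
    ultimately show ?thesis using y(2,3) by simp
  qed
  have zone: "fst (tags m X ! z) = (if z < 8 * m then 0 else if z < 16 * m then 1 else 2)" if "z < n" for z
    using nth_tags(1)[of z m X] nth_tags(2)[of m z X] nth_tags(3)[of m z X] that len(1) by auto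
  have step: "u + y < 16 * m \<and> v + y < 16 * m \<and> (u + y < 8 * m \<longleftrightarrow> v + y < 8 * m)"
    if y: "y \<le> k" "u + y < n" "v + y < n" for y
  proof -
    obtain t a j where x: "tags m X ! (u + y) = (t, a, j)" by (cases "tags m X ! (u + y)")
    obtain t' a' j' where x': "tags m X ! (v + y) = (t', a', j')" by (cases "tags m X ! (v + y)")
    have s: "t = t'" "\<not> t < 2 \<longrightarrow> a = a'" using sim[OF y] unfolding x x' similar_iff by auto
    have z: "t = (if u + y < 8 * m then 0 else if u + y < 16 * m then 1 else 2)"
      "t' = (if v + y < 8 * m then 0 else if v + y < 16 * m then 1 else 2)"
      using zone[OF y(2)] zone[OF y(3)] x x' by simp_all
    \<comment> \<open>Similar bridge positions coincide, which would force
      \<open>u = v\<close>.\<close>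
    have "u + y < 16 * m"
    proof (rule ccontr)
      assume "\<not> u + y < 16 * m"
      moreover from this have "\<not> v + y < 16 * m" using z s(1) by (simp split: if_splits)
      ultimately have "a = u + y - 16 * m" "a' = v + y - 16 * m" "\<not> t < 2"
        using nth_tags(3)[of m "u + y" X] nth_tags(3)[of m "v + y" X] x x' y len(1) z by auto
      with s(2) \<open>\<not> u + y < 16 * m\<close> \<open>\<not> v + y < 16 * m\<close> uv show False by simp
    qed
    moreover have "(if u + y < 8 * m then 0 else if u + y < 16 * m then 1 else 2 :: nat)
        = (if v + y < 8 * m then 0 else if v + y < 16 * m then 1 else 2)"
      using z s(1) by simp
    ultimately show ?thesis
      by (cases "u + y < 8 * m"; cases "v + y < 8 * m"; cases "v + y < 16 * m") simp_all
  qed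
  have inside: "u + y < 16 * m \<and> v + y < 16 * m \<and> (u + y < 8 * m \<longleftrightarrow> v + y < 8 * m)" if "y \<le> k" for y
    using that
  proof (induction y)
    case 0 then show ?case using step[of 0] u v by simp
  next
    case (Suc y)
    then show ?case using step[of "Suc y"] len by simp
  qed
  \<comment> \<open>Neither path leaves its half: both would have to cross the border at the same
    \<open>y\<close>, again forcing \<open>u = v\<close>.\<close>
  have "\<exists>s\<in>{0, 8 * m}. s \<le> u \<and> s \<le> v \<and> u + k < s + 8 * m \<and> v + k < s + 8 * m"
  proof (cases "u < 8 * m")
    case True
    then have v8: "v < 8 * m" using inside[of 0] by simp
    have "u + k < 8 * m"
    proof (rule ccontr)
      assume "\<not> u + k < 8 * m"
      then have "8 * m - u \<le> k" by simp
      moreover obtain y where y: "8 * m - u = Suc y" using True by (cases "8 * m - u") auto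
      ultimately show False using inside[of "Suc y"] inside[of y] uv by auto
    qed
    with v8 inside[of k] show ?thesis by auto
  next
    case False
    with inside[of 0] inside[of k] show ?thesis by auto
  qed
  then obtain s where s: "s \<in> {0, 8 * m}" "s \<le> u" "s \<le> v" "u + k < s + 8 * m" "v + k < s + 8 * m" by blast
  obtain u' where u': "u = s + u'" using s(2) by (metis le_iff_add)
  obtain v' where v': "v = s + v'" using s(3) by (metis le_iff_add)
  show False
  proof (cases rule: v_cases)
    case 1
    define \<tau> where "\<tau> = (if s = 0 then tau else (\<lambda>b. tau (m - 1 - b)))"
    have tags: "\<exists>t<2. \<forall>z<8 * m. tags m X ! (s + z) = (t, \<tau> (z div 8), z mod 8)"
    proof (cases "s = 0")
      case True then show ?thesis by (intro exI[of _ 0]) (simp add: nth_tags(1) \<tau>_def)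
    next
      case False
      with s(1) have s': "s = 8 * m" by simp
      have "tags m X ! (s + z) = (1, \<tau> (z div 8), z mod 8)" if "z < 8 * m" for z
        using nth_tags(2)[of m "8 * m + z" X] that False s' by (simp add: \<tau>_def)
      then show ?thesis by (intro exI[of _ 1]) simp
    qed
    then obtain t where t: "t < 2" "\<And>z. z < 8 * m \<Longrightarrow> tags m X ! (s + z) = (t, \<tau> (z div 8), z mod 8)" by blast
    have vu: "v' = u' + p" using 1 u' v' by simp
    have "3 * (k + 6) \<le> p"
    proof (rule block_repetition)
      show "1 \<le> p" using p by simp
      show "u' + p + k < 8 * m" using s(5) v' vu by simp
      show "\<tau> = tau \<or> \<tau> = (\<lambda>b. tau (m - 1 - b))" by (simp add: \<tau>_def)
      fix y assume y: "y \<le> k"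
      have b: "u' + y < 8 * m" "u' + p + y < 8 * m" using s(4,5) u' v' vu y by auto
      have "similar (tags m X ! (s + (u' + y))) (tags m X ! (s + (u' + p + y)))"
        using sim[of y] inside[OF y] y len u' v' vu by (simp add: add.assoc)
      then show "(u' + y) mod 8 = (u' + p + y) mod 8 \<and>
          \<tau> ((u' + y) div 8) mod 10 = \<tau> ((u' + p + y) div 8) mod 10"
        unfolding t(2)[OF b(1)] t(2)[OF b(2)] similar_iff using t(1) by simp
    qed
    with l lk show False by simp
  next
    case 2
    \<comment> \<open>The distance wraps around the other half. Here
      \<open>l \<le> n - p \<le> u'\<close> and \<open>u' + l \<le> 8 * m + 5\<close> bound
      \<open>2 * l\<close>, while \<open>p \<ge> 8 * m + 5 + l\<close> as the bridge has at least 10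
      letters.\<close>
    have "u' + p = v' + n" using 2 u' v' by simp
    moreover have "u' + k < 8 * m" using s(4) u' by simp
    ultimately show False using len p(2) l lk by linarith
  qed
qed

section \<open>Transfer to circular words over an arbitrary alphabet\<close>

text \<open>For a factor \<open>u\<close> with minimal period \<open>p\<close>, the
  \<open>length u - p\<close> agreements at distance \<open>p\<close> pull back along the injective
  renaming to \<open>w\<close>.\<close>

lemma circular_plus_free_map:
  assumes free: "cyclic_free w" and inj: "inj_on f (set w)"
  shows "circular_plus_free (4 / 3) (circular_word (map f w))"
  unfolding circular_plus_free_def
proof
  assume "\<exists>u. u \<noteq> [] \<and> circular_factor u (circular_word (map f w)) \<and> exponent u > 4 / 3"
  then obtain u x where u: "u \<noteq> []" "exponent u > 4 / 3" "sublist u x" "x \<in> circular_word (map f w)"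
    by (auto simp: circular_factor_def)
  obtain a b where ab: "map f w = a @ b" "x = b @ a"
    using u(4) by (auto simp: circular_word_def conjugates_def)
  obtain ps ss where x: "x = ps @ u @ ss" using u(3) by (auto simp: sublist_def)
  let ?n = "length w"
  have n: "length a + length b = ?n" "length x = ?n" using ab by (metis length_append length_map, metis length_append length_map add.commute)
  have "0 < ?n" unfolding n(2)[symmetric] x using u(1) by simp
  have rot: "x = rotate (length a) (map f w)" using ab by (simp add: rotate_append)
  define p l where "p = min_period u" and "l = length u - p"
  have "has_period u (length u)" using u(1) by (simp add: has_period_def Suc_le_eq)
  then have per: "has_period u p" and "p \<le> length u"
    unfolding p_def min_period_def by (auto intro: LeastI Least_le)
  then have p: "1 \<le> p" "length u = p + l" by (simp_all add: has_period_def l_def)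
  define i where "i = (length a + length ps) mod ?n"
  have nth: "u ! y = f (w ! ((i + y) mod ?n))" if "y < length u" for y
  proof -
    have "u ! y = x ! (length ps + y)" using that x by (simp add: nth_append)
    also have "\<dots> = map f w ! ((length a + (length ps + y)) mod ?n)"
      unfolding rot using that x n(2) by (subst nth_rotate) simp_all
    also have "\<dots> = f (w ! ((length a + (length ps + y)) mod ?n))" using \<open>0 < ?n\<close> by simp
    finally show ?thesis by (simp add: i_def mod_simps add.assoc)
  qed
  have "3 * l \<le> p"
  proof -
    have "w ! ((i + y) mod ?n) = w ! ((i + p + y) mod ?n)" if y: "y < l" for y
    proof -
      have "u ! (y + p) = u ! y" using per p(2) y by (simp add: has_period_def)
      then have "f (w ! ((i + y) mod ?n)) = f (w ! ((i + p + y) mod ?n))"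
        using nth[of y] nth[of "y + p"] p(2) y by (simp add: add_ac)
      then show ?thesis using inj \<open>0 < ?n\<close> by (auto dest: inj_onD)
    qed
    moreover have "i < ?n" using \<open>0 < ?n\<close> by (simp add: i_def)
    moreover have "p + l \<le> ?n" using p(2) n(2) x by simp
    ultimately show ?thesis using free p(1) unfolding cyclic_free_def by blast
  qed
  then have "3 * length u \<le> 4 * p" using p(2) by simp
  then have "3 * real (length u) \<le> 4 * real p" by linarith
  then have "exponent u \<le> 4 / 3" using p(1) by (simp add: exponent_def p_def[symmetric] field_simps)
  with u(2) show False by simp
qed

section \<open>Short lengths and the choice of the bridge\<close>

definition short_words :: "nat list list" where
  "short_words = [
    [],
    [0,1],
    [0,4,1,2],
    [0,4,2,3,1,2],
    [0,2,4,0,1,2,3,1],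
    [0,3,2,4,1,3,0,1,4,2],
    [0,2,3,1,2,0,1,4,2,1,3,4],
    [0,2,1,3,0,1,2,4,3,2,0,3,1,4],
    [0,1,3,2,4,0,3,4,2,3,0,4,1,2,4,3],
    [0,4,1,3,2,4,0,1,2,0,3,4,2,1,0,2,4,3],
    [0,1,4,3,1,2,3,4,1,3,0,4,3,2,4,1,2,0,3,4],
    [0,4,1,3,2,1,0,3,1,4,3,2,4,0,2,3,0,1,2,4,3,1],
    [0,3,1,0,4,3,0,1,4,0,3,2,0,1,2,3,1,4,0,2,4,1,3,2],
    [0,3,2,4,0,1,2,0,4,2,3,0,2,1,0,4,1,3,4,0,3,1,2,3,4,2],
    [0,1,4,0,3,1,2,0,4,3,0,1,2,4,1,3,2,0,4,2,3,4,1,0,2,4,3,2],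
    [0,3,2,4,0,2,3,1,4,3,2,1,0,3,1,2,0,1,4,2,1,0,2,4,3,1,2,3,4,2],
    [0,2,4,1,3,4,2,1,4,0,1,2,0,3,2,1,3,0,2,3,4,2,1,0,2,4,3,1,4,2,3,4],
    [0,1,3,2,4,3,1,2,3,4,0,1,3,0,4,2,1,4,0,3,4,2,3,1,4,3,2,1,3,4,1,0,4,3],
    [0,1,4,3,1,2,4,0,1,3,4,2,0,3,1,0,4,3,2,1,3,4,1,0,3,1,4,0,1,2,0,4,1,0,2,3],
    [0,3,2,1,4,0,2,4,3,1,0,3,4,1,2,3,0,2,1,0,3,1,2,4,1,3,2,1,4,3,1,2,3,0,1,3,4,2],
    [0,3,1,0,4,2,1,3,0,1,4,0,3,4,1,0,4,2,3,4,0,2,4,1,2,3,0,4,3,1,2,4,0,3,2,1,3,4,1,2],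
    [0,2,1,4,3,2,4,0,2,3,0,4,3,1,2,4,1,3,2,0,4,3,0,2,1,0,3,4,2,3,0,4,3,1,4,0,2,4,1,2,3,1],
    [0,1,2,0,4,2,3,4,0,2,1,3,2,4,1,0,3,4,0,1,3,0,2,3,4,2,1,0,2,4,3,1,2,0,4,1,0,3,1,4,0,2,4,3],
    [0,2,3,1,4,2,1,3,4,0,1,2,4,3,2,0,4,1,0,3,4,0,2,1,4,3,0,1,2,3,1,4,2,1,0,4,3,0,2,4,1,3,2,0,3,4],
    [0,1,3,4,0,3,1,2,3,0,4,3,2,0,3,1,0,2,4,0,1,4,2,0,3,4,1,3,2,1,0,4,3,1,2,3,0,4,2,1,0,3,4,1,2,0,4,3],
    [0,2,1,4,3,2,0,4,2,3,1,4,0,2,1,0,4,1,3,0,2,3,4,0,3,2,4,1,2,3,1,4,3,0,2,4,1,3,4,2,3,1,2,4,0,1,3,0,4,1],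
    [0,2,1,4,3,1,2,0,1,4,2,1,0,4,3,0,1,2,3,1,4,0,1,3,4,1,0,3,2,1,4,3,0,2,3,1,2,0,3,2,4,1,0,4,3,1,4,2,1,3,2,4],
    [0,2,1,4,2,0,3,2,4,3,0,2,1,0,4,3,2,0,3,4,1,3,2,1,0,2,3,4,0,3,2,4,3,1,4,0,1,3,2,0,3,1,0,2,3,4,1,2,0,1,4,3,2,4],
    [0,3,4,0,2,4,3,2,1,0,4,1,2,0,1,4,0,2,1,3,4,1,2,4,3,2,1,4,2,3,4,1,3,2,4,0,3,4,2,1,0,2,4,3,0,4,1,3,2,1,0,4,3,0,1,2]]"

text \<open>Every conjugate is a factor of \<open>w @ w\<close>; the bound \<open>length w\<close>
  restricts the check to repetitions that fit into one conjugate.\<close>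

definition cyclic_run_free :: "nat list \<Rightarrow> bool" where
  "cyclic_run_free w = run_free 3 (length w) (w @ w)"

lemma short_words_run_free: "list_all cyclic_run_free short_words"
  by (simp add: short_words_def cyclic_run_free_def cong: no_run_weak_cong no_runs_weak_cong)

lemma cyclic_run_free_sound:
  assumes "cyclic_run_free w" shows "cyclic_free w"
  unfolding cyclic_free_def
proof (intro allI impI)
  fix i p l
  assume i: "i < length w" and p: "1 \<le> p" "p + l \<le> length w"
    and eq: "\<forall>x<l. w ! ((i + x) mod length w) = w ! ((i + p + x) mod length w)"
  show "3 * l \<le> p"
  proof (rule ccontr)
    assume "\<not> 3 * l \<le> p"
    then have l: "p div 3 < l" by linarith
    then have "p + p div 3 < length w" using p(2) by linarith
    moreover from this have "i + p + p div 3 < length (w @ w)" using i by simp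
    ultimately obtain j where j: "j \<le> p div 3" "(w @ w) ! (i + j) \<noteq> (w @ w) ! (i + p + j)"
      using run_free_sound[OF assms[unfolded cyclic_run_free_def] p(1)] by blast
    have "(w @ w) ! y = w ! (y mod length w)" if "y < 2 * length w" for y
    proof (cases "y < length w")
      case False
      then obtain z where "y = length w + z" by (metis le_iff_add linorder_not_less)
      with that show ?thesis by simp
    qed (simp add: nth_append)
    moreover have "i + j < 2 * length w" "i + p + j < 2 * length w" using i p(2) j(1) l by linarith+
    moreover have "w ! ((i + j) mod length w) = w ! ((i + p + j) mod length w)" using eq j(1) l by simp
    ultimately show False using j(2) by simp
  qed
qed

lemma cyclic_free_tags:
  assumes X: "X \<in> set bridges" and m: "3 \<le> m"
  shows "cyclic_free (map (letter X) (tags m X))"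
  unfolding cyclic_free_def
proof (intro allI impI)
  let ?n = "length (tags m X)"
  fix i p l
  assume a: "i < length (map (letter X) (tags m X))" "1 \<le> p" "p + l \<le> length (map (letter X) (tags m X))"
    and eq: "\<forall>x<l. map (letter X) (tags m X) ! ((i + x) mod length (map (letter X) (tags m X))) =
      map (letter X) (tags m X) ! ((i + p + x) mod length (map (letter X) (tags m X)))"
  then have i: "i < ?n" and p: "p + l \<le> ?n" by simp_all
  have "0 < ?n" using i by linarith
  then have eq': "letter X (tags m X ! ((i + x) mod ?n)) = letter X (tags m X ! ((i + p + x) mod ?n))" if "x < l" for x
    using eq that by (simp del: length_tags)
  show "3 * l \<le> p"
  proof (cases "p \<le> 17")
    case True then show ?thesis using short_period[OF X m refl i a(2) _ eq'] by blast
  next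
    case False then show ?thesis using long_period[OF X _ refl i _ p eq'] m by auto
  qed
qed

lemma cyclic_free_exists:
  "\<exists>w :: nat list. set w \<subseteq> {0..<5} \<and> length w = 2 * n \<and> cyclic_free w"
proof (cases "n \<le> 28")
  case True
  have "\<forall>n<29. length (short_words ! n) = 2 * n" 
    by (simp add: short_words_def all_less_Suc numeral_eq_Suc)
  moreover have "length short_words = 29" by (simp add: short_words_def)
  moreover have "\<forall>w\<in>set short_words. set w \<subseteq> {0..<5}" by (simp add: short_words_def)
  moreover have "cyclic_free w" if "w \<in> set short_words" for w
    using that short_words_run_free by (auto simp: list_all_iff intro: cyclic_run_free_sound)
  ultimately show ?thesis using True by (intro exI[of _ "short_words ! n"]) simp
next
  case False
  \<comment> \<open>Bridge \<open>r\<close> has \<open>2 * r + 10\<close> letters, so the total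
    length is 16 m + 2 r + 10 = 2 n; \<open>n \<ge> 29\<close> gives the \<open>m \<ge> 3\<close>
    needed for the contexts of short distances.\<close>
  define m r where "m = (n - 5) div 8" and "r = (n - 5) mod 8"
  have nm: "n = 8 * m + r + 5" and r: "r < 8" using False by (simp_all add: m_def r_def)
  have m: "3 \<le> m" using nm r False by linarith
  have "\<forall>r<8. length (bridges ! r) = 2 * r + 10"
    by (simp add: bridges_def all_less_Suc numeral_eq_Suc)
  with r have lenX: "length (bridges ! r) = 2 * r + 10" by blast
  have X: "bridges ! r \<in> set bridges" using r by (intro nth_mem) (simp add: bridges_def)
  have digits: "\<forall>X\<in>set bridges. set X \<subseteq> {0..<5}" by (simp add: bridges_def)
  have "letter (bridges ! r) x < 5" if "x \<in> set (tags m (bridges ! r))" for x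
  proof -
    obtain t a j where x: "x = (t, a, j)" by (cases x)
    with that have "t < 2 \<or> a < length (bridges ! r)"
      by (auto simp: tags_def blocks_def bridge_def)
    moreover have "bridges ! r ! a < 5" if "a < length (bridges ! r)"
      using that digits X nth_mem by fastforce
    ultimately show ?thesis using x by auto
  qed
  then show ?thesis using cyclic_free_tags[OF X m] nm lenX
    by (intro exI[of _ "map (letter (bridges ! r)) (tags m (bridges ! r))"]) auto
qed

theorem theorem4p5:
  fixes A :: "'a set" and n :: nat
  assumes "card A = 5"
  shows "\<exists>w. set w \<subseteq> A \<and> length w = 2 * n \<and> circular_plus_free (4 / 3) (circular_word w)"
proof -
  have "finite A" using assms by (intro card_ge_0_finite) simp
  then obtain f :: "nat \<Rightarrow> 'a" where f: "bij_betw f {0..<5} A" using ex_bij_betw_nat_finite[of A] assms by auto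
  obtain w :: "nat list" where w: "set w \<subseteq> {0..<5}" "length w = 2 * n" "cyclic_free w"
    using cyclic_free_exists by blast
  have "inj_on f (set w)" using f w(1) by (auto simp: bij_betw_def intro: inj_on_subset)
  moreover have "set (map f w) \<subseteq> A" using f w(1) by (auto simp: bij_betw_def)
  ultimately show ?thesis using circular_plus_free_map[OF w(3)] w(2) by (intro exI[of _ "map f w"]) simp
qed

end
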